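(* Let $G$ be a graph on $n$ vertices with Randić matrix $R$ and $R$-spectrum $\sigma_R$, and let $\Psi$ be a sub-multiset of $\sigma_R$. Then $$RE(G)\leq \sqrt{(n-|\Psi|)\left(\operatorname{tr}(R^2)-\sum_{\lambda\in\Psi}\lambda^2\right)}+\sum_{\lambda\in\Psi}|\lambda|,$$ where sums over $\Psi$ and the cardinality $|\Psi|$ are taken with multiplicity.
   Context: Graphs are finite, simple and undirected. For a graph $G$ with vertex set $V$, edge set $E$ and vertex degrees $d_u$, the Randić matrix $R=[r_{uv}]$ is the real symmetric matrix indexed by $V$ with $r_{uv}=1/\sqrt{d_ud_v}$ if $uv\in E$ and $r_{uv}=0$ otherwise. The $R$-spectrum $\sigma_R=\{\lambda_1,\dots,\lambda_n\}$ is the multiset of eigenvalues of $R$ (with multiplicity). The Randić energy is $RE(G)=\sum_{i=1}^n|\lambda_i|$. *)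

theory Defs
  imports Complex_Main
    "HOL-Library.Multiset"
    "Graph_Theory.Digraph"
    "Jordan_Normal_Form.Char_Poly"
begin

text \<open>
  Finite simple undirected graphs are the locale \<^locale>\<open>graph\<close>, i.e. finite symmetric digraphs
  without loops and parallel arcs: \<open>uv\<close> is an edge iff \<open>(u, v) \<in> arcs_ends G\<close>, and the degree of
  \<open>u\<close> is its out-degree. Matrix indices are natural numbers, so the matrix is
  taken with respect to a list \<open>vs\<close> enumerating the vertices without repetition.
\<close>

definition randic_matrix :: "('a, 'b) pre_digraph \<Rightarrow> 'a list \<Rightarrow> real mat" where
  "randic_matrix G vs = mat (length vs) (length vs) (\<lambda>(i, j).
     if (vs ! i, vs ! j) \<in> arcs_ends G
     then 1 / sqrt (real (out_degree G (vs ! i)) * real (out_degree G (vs ! j)))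
     else 0)"

text \<open>
  Real eigenvalues with their algebraic multiplicities. For a symmetric real matrix, such as the
  Randic matrix, these are all the eigenvalues, and algebraic and geometric multiplicities agree.
\<close>

definition spectrum_mset :: "real mat \<Rightarrow> real multiset" where
  "spectrum_mset A = proots (char_poly A)"

definition mat_trace :: "'a :: comm_monoid_add mat \<Rightarrow> 'a" where
  "mat_trace A = (\<Sum>i<dim_row A. A $$ (i, i))"

definition randic_energy :: "('a, 'b) pre_digraph \<Rightarrow> 'a list \<Rightarrow> real" where
  "randic_energy G vs = (\<Sum>\<mu>\<in>#spectrum_mset (randic_matrix G vs). \<bar>\<mu>\<bar>)"

end

theory Submission
  imports Defs "Jordan_Normal_Form.Schur_Decomposition"
begin

text \<open>
  The Randic matrix \<open>R\<close> is real and symmetric, so its characteristic polynomial splits over the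
  reals: its \<open>n\<close> complex roots are all real (\<open>symmetric_char_poly_splits\<close>). Hence its real spectrum
  has exactly \<open>n\<close> members, and a Schur triangularisation, which preserves the trace of \<open>R\<^sup>2\<close>,
  shows that their squares add up to the trace of \<open>R\<^sup>2\<close> (\<open>symmetric_spectrum\<close>).

  Remove \<open>\<Psi>\<close> from the spectrum. The remaining \<open>n - |\<Psi>|\<close> eigenvalues have squares adding up to
  the trace of \<open>R\<^sup>2\<close> minus the squares in \<open>\<Psi>\<close>, so the Cauchy-Schwarz inequality
  (\<open>sum_mset_abs_le_sqrt\<close>) bounds the sum of their absolute values by the square root in the
  theorem; the eigenvalues in \<open>\<Psi>\<close> contribute their absolute values unchanged.
\<close>

text \<open>
  For an eigenvector \<open>v\<close>, the value \<open>q\<close> of the Hermitian form of \<open>A\<close> at \<open>v\<close> is \<open>e\<close> times the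
  squared norm of \<open>v\<close>. As \<open>A\<close> is real and symmetric, conjugating \<open>q\<close> merely exchanges the two
  summation indices, so \<open>q\<close> and therefore \<open>e\<close> is real.
\<close>

lemma symmetric_complex_eigenvalue_real:
  fixes A :: "real mat"
  assumes A: "A \<in> carrier_mat n n" and sym: "transpose_mat A = A"
    and ev: "eigenvalue (map_mat complex_of_real A) e"
  shows "e \<in> \<real>"
proof -
  let ?C = "map_mat complex_of_real A"
  from ev obtain v where v: "v \<in> carrier_vec n" "v \<noteq> 0\<^sub>v n" "?C *\<^sub>v v = e \<cdot>\<^sub>v v"
    using A unfolding eigenvalue_def eigenvector_def by auto
  define s where "s = (\<Sum>i<n. (cmod (v $ i))\<^sup>2)"
  have Av: "(\<Sum>j<n. of_real (A $$ (i, j)) * v $ j) = e * v $ i" if "i < n" for i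
  proof -
    have "(?C *\<^sub>v v) $ i = (e \<cdot>\<^sub>v v) $ i" using v by simp
    then show ?thesis
      using that A v(1) by (simp add: scalar_prod_def atLeast0LessThan)
  qed
  define q where "q = (\<Sum>i<n. \<Sum>j<n. cnj (v $ i) * (of_real (A $$ (i, j)) * v $ j))"
  have "q = (\<Sum>i<n. cnj (v $ i) * (e * v $ i))"
    unfolding q_def by (intro sum.cong refl) (simp add: Av sum_distrib_left[symmetric])
  also have "\<dots> = (\<Sum>i<n. e * of_real ((cmod (v $ i))\<^sup>2))"
    by (intro sum.cong refl) (simp only: complex_norm_square mult_ac)
  finally have q: "q = e * of_real s"
    by (simp add: s_def sum_distrib_left)
  have symA: "A $$ (i, j) = A $$ (j, i)" if "i < n" "j < n" for i j
    using sym A that by (metis carrier_matD index_transpose_mat(1))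
  have "cnj q = (\<Sum>i<n. \<Sum>j<n. v $ i * (of_real (A $$ (i, j)) * cnj (v $ j)))"
    by (simp add: q_def)
  also have "\<dots> = (\<Sum>j<n. \<Sum>i<n. v $ i * (of_real (A $$ (i, j)) * cnj (v $ j)))"
    by (rule sum.swap)
  also have "\<dots> = q"
    unfolding q_def by (intro sum.cong refl) (simp add: symA mult_ac)
  finally have "q \<in> \<real>" by (simp add: Reals_cnj_iff)
  moreover have "s \<noteq> 0"
  proof
    assume "s = 0"
    then have "\<forall>i<n. v $ i = 0"
      by (simp add: s_def sum_nonneg_eq_0_iff)
    then have "v = 0\<^sub>v n" using v(1) by (intro eq_vecI) auto
    with v(2) show False ..
  qed
  ultimately show ?thesis
    using q by (metis Reals_divide Reals_of_real nonzero_mult_div_cancel_right of_real_eq_0_iff)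
qed

text \<open>
  Over the complex numbers the characteristic polynomial splits. Its roots are real, so the
  factorisation is the image of one over the reals, and embedding the coefficients is injective.
\<close>

lemma symmetric_char_poly_splits:
  fixes A :: "real mat"
  assumes A: "A \<in> carrier_mat n n" and sym: "transpose_mat A = A"
  obtains es where "char_poly A = (\<Prod>e\<leftarrow>es. [:- e, 1:])" "length es = n"
proof -
  interpret h: map_poly_inj_idom_hom complex_of_real ..
  let ?C = "map_mat complex_of_real A"
  have C: "?C \<in> carrier_mat n n" using A by simp
  from char_poly_factorized[OF C] obtain as
    where as: "char_poly ?C = (\<Prod>a\<leftarrow>as. [:- a, 1:])" "length as = n" by blast
  have "eigenvalue ?C a" if "a \<in> set as" for a
    unfolding eigenvalue_root_char_poly[OF C] as(1) using that
    by (auto simp: poly_prod_list)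
  then have real: "a = of_real (Re a)" if "a \<in> set as" for a
    using symmetric_complex_eigenvalue_real[OF A sym] that by simp
  have "map_poly complex_of_real (char_poly A) = (\<Prod>a\<leftarrow>as. [:- a, 1:])"
    unfolding as(1)[symmetric] by (rule comm_ring_hom.char_poly_hom[OF _ A, symmetric]) unfold_locales
  also have "\<dots> = (\<Prod>a\<leftarrow>as. map_poly complex_of_real [:- Re a, 1:])"
    using real by (intro arg_cong[of _ _ prod_list] map_cong refl) simp
  also have "\<dots> = map_poly complex_of_real (\<Prod>e\<leftarrow>map Re as. [:- e, 1:])"
    by (simp add: h.hom_prod_list o_def)
  finally have "char_poly A = (\<Prod>e\<leftarrow>map Re as. [:- e, 1:])"
    by simp
  then show ?thesis by (rule that) (simp add: as(2))
qed

lemma mat_trace_commute: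
  fixes A :: "'a :: comm_semiring_0 mat"
  assumes A: "A \<in> carrier_mat n m" and B: "B \<in> carrier_mat m n"
  shows "mat_trace (A * B) = mat_trace (B * A)"
proof -
  have "mat_trace (A * B) = (\<Sum>i<n. \<Sum>j<m. A $$ (i, j) * B $$ (j, i))"
    using A B by (auto simp: mat_trace_def scalar_prod_def atLeast0LessThan intro!: sum.cong)
  also have "\<dots> = (\<Sum>j<m. \<Sum>i<n. B $$ (j, i) * A $$ (i, j))"
    by (subst sum.swap) (simp add: mult.commute)
  also have "\<dots> = mat_trace (B * A)"
    using A B by (auto simp: mat_trace_def scalar_prod_def atLeast0LessThan intro!: sum.cong)
  finally show ?thesis .
qed

lemma mat_trace_similar:
  fixes A :: "'a :: comm_semiring_1 mat"
  assumes "similar_mat_wit A B P Q"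
  shows "mat_trace A = mat_trace B"
proof -
  note w = similar_mat_witD[OF refl assms]
  have "A = P * (B * Q)"
    unfolding w(3) by (rule assoc_mult_mat[OF w(6,5,7)])
  then have "mat_trace A = mat_trace (P * (B * Q))"
    by (rule arg_cong)
  also have "\<dots> = mat_trace (B * Q * P)"
    using w(5-7) by (intro mat_trace_commute) auto
  also have "B * Q * P = B * (Q * P)"
    by (rule assoc_mult_mat[OF w(5,7,6)])
  also have "\<dots> = B"
    unfolding w(2) by (rule right_mult_one_mat[OF w(5)])
  finally show ?thesis .
qed

lemma mat_trace_square_upper_triangular:
  fixes B :: "'a :: comm_semiring_1 mat"
  assumes B: "B \<in> carrier_mat n n" and ut: "upper_triangular B"
  shows "mat_trace (B ^\<^sub>m 2) = (\<Sum>b\<leftarrow>diag_mat B. b\<^sup>2)"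
proof -
  have "(\<Sum>j<n. B $$ (i, j) * B $$ (j, i)) = (B $$ (i, i))\<^sup>2" if "i < n" for i
  proof -
    have "B $$ (i, j) * B $$ (j, i) = (if j = i then (B $$ (i, i))\<^sup>2 else 0)" if "j < n" for j
      using ut B \<open>i < n\<close> that
      by (cases i j rule: linorder_cases) (auto simp: power2_eq_square upper_triangularD)
    then show ?thesis using that by simp
  qed
  then have "mat_trace (B ^\<^sub>m 2) = (\<Sum>i<n. (B $$ (i, i))\<^sup>2)"
    using B by (auto simp: mat_trace_def numeral_2_eq_2 scalar_prod_def atLeast0LessThan
        intro!: sum.cong)
  also have "\<dots> = (\<Sum>b\<leftarrow>diag_mat B. b\<^sup>2)"
    using B by (simp add: diag_mat_def o_def interv_sum_list_conv_sum_set_nat atLeast0LessThan)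
  finally show ?thesis .
qed

lemma proots_linear_factors: "proots (\<Prod>e\<leftarrow>es. [:- e, 1:]) = mset (es :: 'a :: idom list)"
  by (induction es) (simp_all add: proots_mult image_iff del: mult_pCons_left)

text \<open>
  A real splitting makes Schur's theorem available over the reals: \<open>A\<close> is similar to an upper
  triangular matrix with the eigenvalues on its diagonal. Its square has the squared eigenvalues
  on the diagonal, and \<open>A\<^sup>2\<close> has the same trace as this square.
\<close>

lemma symmetric_spectrum:
  fixes A :: "real mat"
  assumes A: "A \<in> carrier_mat n n" and sym: "transpose_mat A = A"
  shows size_symmetric_spectrum: "size (spectrum_mset A) = n"
    and sum_squares_symmetric_spectrum: "(\<Sum>\<mu>\<in>#spectrum_mset A. \<mu>\<^sup>2) = mat_trace (A ^\<^sub>m 2)"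
proof -
  from symmetric_char_poly_splits[OF A sym] obtain es
    where es: "char_poly A = (\<Prod>e\<leftarrow>es. [:- e, 1:])" "length es = n" .
  then have spec: "spectrum_mset A = mset es"
    by (simp add: spectrum_mset_def proots_linear_factors)
  show "size (spectrum_mset A) = n" using spec es(2) by simp
  obtain B P Q where "schur_decomposition A es = (B, P, Q)" by (cases "schur_decomposition A es")
  from schur_decomposition[OF A es(1) this]
  have w: "similar_mat_wit A B P Q" and ut: "upper_triangular B" and d: "diag_mat B = es" by auto
  have "mat_trace (A ^\<^sub>m 2) = mat_trace (B ^\<^sub>m 2)"
    by (rule mat_trace_similar[OF similar_mat_wit_pow[OF w]])
  also have "\<dots> = (\<Sum>e\<leftarrow>es. e\<^sup>2)"
    using mat_trace_square_upper_triangular[OF similar_mat_witD2(5)[OF A w] ut] d by simp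
  also have "\<dots> = (\<Sum>\<mu>\<in>#spectrum_mset A. \<mu>\<^sup>2)"
    by (simp add: spec sum_mset_sum_list flip: mset_map)
  finally show "(\<Sum>\<mu>\<in>#spectrum_mset A. \<mu>\<^sup>2) = mat_trace (A ^\<^sub>m 2)" ..
qed

text \<open>
  Cauchy-Schwarz against the all-ones vector, in its variance form: the deviations of the
  \<open>\<bar>x\<bar>\<close> from their mean have a nonnegative sum of squares.
\<close>

lemma sum_mset_abs_le_sqrt:
  fixes M :: "real multiset"
  shows "(\<Sum>x\<in>#M. \<bar>x\<bar>) \<le> sqrt (real (size M) * (\<Sum>x\<in>#M. x\<^sup>2))"
proof (cases "M = {#}")
  case False
  define k S Q where "k = real (size M)" and "S = (\<Sum>x\<in>#M. \<bar>x\<bar>)" and "Q = (\<Sum>x\<in>#M. x\<^sup>2)"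
  have k: "k > 0" using False by (simp add: k_def nonempty_has_size)
  \<comment> \<open>The deviations are scaled by \<open>k\<close> to avoid dividing. For the induction on \<open>M\<close>, the constants
    \<open>k\<close> and \<open>t\<close> (later \<open>S\<close>) must not vary with \<open>M\<close>, so one occurrence of \<open>size M\<close> is
    kept apart from \<open>k\<close>.\<close>
  have expand: "(\<Sum>x\<in>#M. (k * \<bar>x\<bar> - t)\<^sup>2) = k\<^sup>2 * Q - 2 * k * t * S + real (size M) * t\<^sup>2" for t
    unfolding S_def Q_def
    by (induction M) (simp_all add: power2_eq_square algebra_simps)
  have "0 \<le> (\<Sum>x\<in>#M. (k * \<bar>x\<bar> - S)\<^sup>2)" by (induction M) auto
  also have "\<dots> = k * (k * Q - S\<^sup>2)"
    unfolding expand k_def[symmetric] by (simp add: power2_eq_square algebra_simps)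
  finally have "S\<^sup>2 \<le> k * Q" using k by (simp add: zero_le_mult_iff)
  then show ?thesis
    unfolding S_def k_def Q_def by (rule real_le_rsqrt)
qed simp

lemma randic_matrix_carrier: "randic_matrix G vs \<in> carrier_mat (length vs) (length vs)"
  by (simp add: randic_matrix_def)

lemma symmetric_randic_matrix:
  assumes "symmetric G"
  shows "transpose_mat (randic_matrix G vs) = randic_matrix G vs"
  by (rule eq_matI) (use assms in \<open>auto simp: randic_matrix_def mult.commute arcs_ends_symmetric\<close>)

theorem theorem3p3:
  fixes G :: "('a, 'b) pre_digraph" and vs :: "'a list" and n :: nat
    and R :: "real mat" and \<Psi> :: "real multiset"
  assumes "graph G"
    and "distinct vs" and "set vs = verts G"
    and "n = card (verts G)"
    and "R = randic_matrix G vs"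
    and "\<Psi> \<subseteq># spectrum_mset R"
  shows "randic_energy G vs \<le>
    sqrt ((real n - real (size \<Psi>)) * (mat_trace (R ^\<^sub>m 2) - (\<Sum>\<mu>\<in>#\<Psi>. \<mu>\<^sup>2))) + (\<Sum>\<mu>\<in>#\<Psi>. \<bar>\<mu>\<bar>)"
proof -
  interpret graph G by fact
  have "length vs = n" using assms(2-4) distinct_card by metis
  then have R: "R \<in> carrier_mat n n" using randic_matrix_carrier assms(5) by blast
  have sym: "transpose_mat R = R" using symmetric_randic_matrix[OF sym_arcs] assms(5) by simp
  define \<Phi> where "\<Phi> = spectrum_mset R - \<Psi>"
  have split: "spectrum_mset R = \<Phi> + \<Psi>" using assms(6) by (simp add: \<Phi>_def)
  have "randic_energy G vs = (\<Sum>\<mu>\<in>#\<Phi>. \<bar>\<mu>\<bar>) + (\<Sum>\<mu>\<in>#\<Psi>. \<bar>\<mu>\<bar>)"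
    using split assms(5) by (simp add: randic_energy_def)
  moreover have "real n - real (size \<Psi>) = real (size \<Phi>)"
    using size_symmetric_spectrum[OF R sym] split by simp
  moreover have "mat_trace (R ^\<^sub>m 2) - (\<Sum>\<mu>\<in>#\<Psi>. \<mu>\<^sup>2) = (\<Sum>\<mu>\<in>#\<Phi>. \<mu>\<^sup>2)"
    using sum_squares_symmetric_spectrum[OF R sym] split by simp
  ultimately show ?thesis using sum_mset_abs_le_sqrt[of \<Phi>] by simp
qed

end
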